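(* Let $(A,\ast,\alpha)$ be a Hom-Novikov superalgebra over a field $\mathbf{F}$. The coboundary operators $\delta^1_{hom}:C^1_\alpha(A,A)\to C^2_\alpha(A,A)$ and $\delta^2_{hom}:C^2_\alpha(A,A)\to C^3_\alpha(A,A)$ satisfy $\delta^2_{hom}\delta^1_{hom}=0$.
   Context: $\mathbf{F}$ is an arbitrary field. All graded spaces are $\mathbb{Z}_2$-graded, $A=A_{\bar 0}\oplus A_{\bar 1}$, $|x|$ is the degree of a homogeneous element $x$, and identities involving signs are for homogeneous elements. A Hom-Novikov superalgebra is a triple $(A,\ast,\alpha)$, where $A$ is a $\mathbb{Z}_2$-graded vector space, $\ast$ is an even bilinear product (degrees add) and $\alpha:A\to A$ is an even (degree-preserving) linear map, such that for all homogeneous $x,y,z$: (1) $\alpha(x\ast y)=\alpha(x)\ast\alpha(y)$; (2) $(x\ast y)\ast\alpha(z)-\alpha(x)\ast(y\ast z)=(-1)^{|x||y|}\big((y\ast x)\ast\alpha(z)-\alpha(y)\ast(x\ast z)\big)$; (3) $(x\ast y)\ast\alpha(z)=(-1)^{|y||z|}(x\ast z)\ast\alpha(y)$. For $n\ge 1$, an $n$-Hom-cochain is an $n$-linear map $f:A\times\cdots\times A\to A$ with $\alpha(f(x_1,\dots,x_n))=f(\alpha(x_1),\dots,\alpha(x_n))$; $C^n_\alpha(A,A)$ is the space of all $n$-Hom-cochains. $f$ is homogeneous of degree $|f|\in\mathbb{Z}_2$ if $f(A_{i_1},\dots,A_{i_n})\subseteq A_{i_1+\cdots+i_n+|f|}$.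 The coboundary operators are given on homogeneous $f$ and homogeneous arguments (and extended linearly) by $$\delta^1_{hom}f(x_1,x_2)=(-1)^{|x_1||f|}x_1\ast f(x_2)+f(x_1)\ast x_2-f(x_1\ast x_2),$$ $$\begin{aligned}\delta^2_{hom}f(x_1,x_2,x_3)={}&f(\alpha(x_1),x_2\ast x_3)-(-1)^{|x_1||x_2|}f(\alpha(x_2),x_1\ast x_3)+(-1)^{|x_1||x_2|}f(x_2\ast x_1,\alpha(x_3))\\&+(-1)^{|x_1||f|}\alpha(x_1)\ast f(x_2,x_3)-(-1)^{|x_1||x_2|+|x_2||f|}\alpha(x_2)\ast f(x_1,x_3)\\&+(-1)^{|x_1||x_2|}f(x_2,x_1)\ast\alpha(x_3)-(-1)^{|x_2||x_3|}f(x_1\ast x_3,\alpha(x_2))-(-1)^{|x_2||x_3|}f(x_1,x_3)\ast\alpha(x_2).\end{aligned}$$ *)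

theory Defs
  imports Complex_Main "HOL-Library.Z2" "HOL-Library.FuncSet"
begin

text \<open>
  Degrees live in the field \<^typ>\<open>bit\<close> of integers mod 2, so sums and products of degrees are
  formed in \<open>\<int>\<^sub>2\<close>.  The exponents of \<open>-1\<close> below are such sums and products, and
  \<open>sg e v\<close> is \<open>(-1)\<^sup>e v\<close>.
\<close>

definition sg :: "bit \<Rightarrow> 'a::ab_group_add \<Rightarrow> 'a"
  where "sg e v = (if e = 0 then v else - v)"

locale super_space = vector_space scale
  for scale :: "'k::field \<Rightarrow> 'a::ab_group_add \<Rightarrow> 'a" +
  fixes A :: "bit \<Rightarrow> 'a set"
  assumes subspace_A: "subspace (A i)"
    and A_Int: "A 0 \<inter> A 1 = {0}"
    and A_sum: "\<exists>y\<in>A 0. \<exists>z\<in>A 1. x = y + z"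

locale hom_novikov_superalgebra = super_space scale A
  for scale :: "'k::field \<Rightarrow> 'a::ab_group_add \<Rightarrow> 'a" and A :: "bit \<Rightarrow> 'a set" +
  fixes mul :: "'a \<Rightarrow> 'a \<Rightarrow> 'a" (infixl \<open>\<star>\<close> 70)
    and \<alpha> :: "'a \<Rightarrow> 'a"
  assumes mul_linear_left: "Vector_Spaces.linear scale scale (\<lambda>x. x \<star> y)"
    and mul_linear_right: "Vector_Spaces.linear scale scale (\<lambda>y. x \<star> y)"
    and mul_even: "\<lbrakk>x \<in> A i; y \<in> A j\<rbrakk> \<Longrightarrow> x \<star> y \<in> A (i + j)"
    and \<alpha>_linear: "Vector_Spaces.linear scale scale \<alpha>"
    and \<alpha>_even: "x \<in> A i \<Longrightarrow> \<alpha> x \<in> A i"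
    and \<alpha>_mul: "\<lbrakk>x \<in> A i; y \<in> A j\<rbrakk> \<Longrightarrow> \<alpha> (x \<star> y) = \<alpha> x \<star> \<alpha> y"
    and left_symmetric: "\<lbrakk>x \<in> A i; y \<in> A j; z \<in> A k\<rbrakk> \<Longrightarrow>
      (x \<star> y) \<star> \<alpha> z - \<alpha> x \<star> (y \<star> z)
        = sg (i * j) ((y \<star> x) \<star> \<alpha> z - \<alpha> y \<star> (x \<star> z))"
    and right_commutative: "\<lbrakk>x \<in> A i; y \<in> A j; z \<in> A k\<rbrakk> \<Longrightarrow>
      (x \<star> y) \<star> \<alpha> z = sg (j * k) ((x \<star> z) \<star> \<alpha> y)"

text \<open>The spaces \<open>C\<^sup>n\<^sub>\<alpha>(A,A)\<close> for \<open>n = 1, 2, 3\<close>, with cochains in curried form.\<close>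

definition hom_cochain1 ::
    "('k::field \<Rightarrow> 'a::ab_group_add \<Rightarrow> 'a) \<Rightarrow> ('a \<Rightarrow> 'a) \<Rightarrow> ('a \<Rightarrow> 'a) set"
  where "hom_cochain1 scale \<alpha> =
    {f. Vector_Spaces.linear scale scale f \<and> (\<forall>x. \<alpha> (f x) = f (\<alpha> x))}"

definition hom_cochain2 ::
    "('k::field \<Rightarrow> 'a::ab_group_add \<Rightarrow> 'a) \<Rightarrow> ('a \<Rightarrow> 'a) \<Rightarrow> ('a \<Rightarrow> 'a \<Rightarrow> 'a) set"
  where "hom_cochain2 scale \<alpha> =
    {f. (\<forall>y. Vector_Spaces.linear scale scale (\<lambda>x. f x y)) \<and>
        (\<forall>x. Vector_Spaces.linear scale scale (\<lambda>y. f x y)) \<and>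
        (\<forall>x y. \<alpha> (f x y) = f (\<alpha> x) (\<alpha> y))}"

definition hom_cochain3 ::
    "('k::field \<Rightarrow> 'a::ab_group_add \<Rightarrow> 'a) \<Rightarrow> ('a \<Rightarrow> 'a) \<Rightarrow> ('a \<Rightarrow> 'a \<Rightarrow> 'a \<Rightarrow> 'a) set"
  where "hom_cochain3 scale \<alpha> =
    {f. (\<forall>y z. Vector_Spaces.linear scale scale (\<lambda>x. f x y z)) \<and>
        (\<forall>x z. Vector_Spaces.linear scale scale (\<lambda>y. f x y z)) \<and>
        (\<forall>x y. Vector_Spaces.linear scale scale (\<lambda>z. f x y z)) \<and>
        (\<forall>x y z. \<alpha> (f x y z) = f (\<alpha> x) (\<alpha> y) (\<alpha> z))}"

definition homogeneous1 :: "(bit \<Rightarrow> 'a set) \<Rightarrow> bit \<Rightarrow> ('a \<Rightarrow> 'a) \<Rightarrow> bool"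
  where "homogeneous1 A d f \<longleftrightarrow> (\<forall>i. \<forall>x\<in>A i. f x \<in> A (i + d))"

definition homogeneous2 :: "(bit \<Rightarrow> 'a set) \<Rightarrow> bit \<Rightarrow> ('a \<Rightarrow> 'a \<Rightarrow> 'a) \<Rightarrow> bool"
  where "homogeneous2 A d f \<longleftrightarrow> (\<forall>i j. \<forall>x\<in>A i. \<forall>y\<in>A j. f x y \<in> A (i + j + d))"

text \<open>
  The component of \<open>x\<close> in \<open>A i\<close> (note that \<open>i + 1\<close> is the other degree), and the homogeneous
  components of degree \<open>d\<close> of a linear or bilinear map.
\<close>

definition hcomp :: "(bit \<Rightarrow> 'a::ab_group_add set) \<Rightarrow> bit \<Rightarrow> 'a \<Rightarrow> 'a"
  where "hcomp A i x = (THE y. y \<in> A i \<and> x - y \<in> A (i + 1))"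

definition hcomp1 :: "(bit \<Rightarrow> 'a::ab_group_add set) \<Rightarrow> bit \<Rightarrow> ('a \<Rightarrow> 'a) \<Rightarrow> 'a \<Rightarrow> 'a"
  where "hcomp1 A d f x = (\<Sum>i\<in>{0,1}. hcomp A (i + d) (f (hcomp A i x)))"

definition hcomp2 :: "(bit \<Rightarrow> 'a::ab_group_add set) \<Rightarrow> bit \<Rightarrow> ('a \<Rightarrow> 'a \<Rightarrow> 'a) \<Rightarrow> 'a \<Rightarrow> 'a \<Rightarrow> 'a"
  where "hcomp2 A d f x y =
    (\<Sum>i\<in>{0,1}. \<Sum>j\<in>{0,1}. hcomp A (i + j + d) (f (hcomp A i x) (hcomp A j y)))"

text \<open>
  The defining formulas of the coboundary operators on homogeneous data: \<open>d\<close> is the degree of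
  \<open>f\<close>, and \<open>i\<close>, \<open>j\<close>, \<open>k\<close> are the degrees of \<open>x1\<close>, \<open>x2\<close>, \<open>x3\<close>.
\<close>

definition delta1_at :: "('a::ab_group_add \<Rightarrow> 'a \<Rightarrow> 'a) \<Rightarrow> bit \<Rightarrow> bit \<Rightarrow> ('a \<Rightarrow> 'a) \<Rightarrow> 'a \<Rightarrow> 'a \<Rightarrow> 'a"
  where "delta1_at mul d i f x1 x2 = sg (i * d) (x1 \<star> f x2) + f x1 \<star> x2 - f (x1 \<star> x2)"
  for mul (infixl \<open>\<star>\<close> 70)

definition delta2_at :: "('a::ab_group_add \<Rightarrow> 'a \<Rightarrow> 'a) \<Rightarrow> ('a \<Rightarrow> 'a) \<Rightarrow> bit \<Rightarrow> bit \<Rightarrow> bit \<Rightarrow> bit \<Rightarrow>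
    ('a \<Rightarrow> 'a \<Rightarrow> 'a) \<Rightarrow> 'a \<Rightarrow> 'a \<Rightarrow> 'a \<Rightarrow> 'a"
  where "delta2_at mul \<alpha> d i j k f x1 x2 x3 =
      f (\<alpha> x1) (x2 \<star> x3)
    - sg (i * j) (f (\<alpha> x2) (x1 \<star> x3))
    + sg (i * j) (f (x2 \<star> x1) (\<alpha> x3))
    + sg (i * d) (\<alpha> x1 \<star> f x2 x3)
    - sg (i * j + j * d) (\<alpha> x2 \<star> f x1 x3)
    + sg (i * j) (f x2 x1 \<star> \<alpha> x3)
    - sg (j * k) (f (x1 \<star> x3) (\<alpha> x2))
    - sg (j * k) (f x1 x3 \<star> \<alpha> x2)"
  for mul (infixl \<open>\<star>\<close> 70)

text \<open>
  The coboundary operators: the linear extension, in the cochain and in its arguments, of the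
  homogeneous formulas.
\<close>

definition delta1 :: "(bit \<Rightarrow> 'a::ab_group_add set) \<Rightarrow> ('a \<Rightarrow> 'a \<Rightarrow> 'a) \<Rightarrow>
    ('a \<Rightarrow> 'a) \<Rightarrow> 'a \<Rightarrow> 'a \<Rightarrow> 'a"
  where "delta1 A mul f x1 x2 = (\<Sum>d\<in>{0,1}. \<Sum>i\<in>{0,1}. \<Sum>j\<in>{0,1}.
    delta1_at mul d i (hcomp1 A d f) (hcomp A i x1) (hcomp A j x2))"

definition delta2 :: "(bit \<Rightarrow> 'a::ab_group_add set) \<Rightarrow> ('a \<Rightarrow> 'a \<Rightarrow> 'a) \<Rightarrow> ('a \<Rightarrow> 'a) \<Rightarrow>
    ('a \<Rightarrow> 'a \<Rightarrow> 'a) \<Rightarrow> 'a \<Rightarrow> 'a \<Rightarrow> 'a \<Rightarrow> 'a"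
  where "delta2 A mul \<alpha> f x1 x2 x3 = (\<Sum>d\<in>{0,1}. \<Sum>i\<in>{0,1}. \<Sum>j\<in>{0,1}. \<Sum>k\<in>{0,1}.
    delta2_at mul \<alpha> d i j k (hcomp2 A d f) (hcomp A i x1) (hcomp A j x2) (hcomp A k x3))"

text \<open>
  The operators agree with the defining formulas on homogeneous data and are linear.
\<close>

lemma sg_0 [simp]: "sg e 0 = 0"
  by (simp add: sg_def)

context super_space
begin

lemma A_zero: "0 \<in> A i"
  by (rule subspace_0[OF subspace_A])

lemma A_Int': "\<lbrakk>x \<in> A i; x \<in> A (i + 1)\<rbrakk> \<Longrightarrow> x = 0"
  using A_Int by (cases i) auto

lemma hcomp_unique:
  assumes "y \<in> A i" "x - y \<in> A (i + 1)"
  shows "hcomp A i x = y"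
  unfolding hcomp_def
proof (rule the_equality)
  fix z assume z: "z \<in> A i \<and> x - z \<in> A (i + 1)"
  have "z - y \<in> A i"
    using z assms by (simp add: subspace_diff subspace_A)
  moreover have "(x - y) - (x - z) \<in> A (i + 1)"
    using z assms by (blast intro: subspace_diff subspace_A)
  ultimately have "z - y = 0"
    by (intro A_Int') simp_all
  then show "z = y" by simp
qed (use assms in simp)

lemma hcomp_in: "hcomp A i x \<in> A i" "x - hcomp A i x \<in> A (i + 1)"
proof -
  obtain y z where yz: "y \<in> A 0" "z \<in> A 1" "x = y + z"
    using A_sum by blast
  have "\<exists>y. y \<in> A i \<and> x - y \<in> A (i + 1)"
  proof (cases i)
    assume "i = 0"
    then show ?thesis using yz by (intro exI[of _ y]) simp
  next
    assume "i = 1"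
    then show ?thesis using yz by (intro exI[of _ z]) simp
  qed
  then show "hcomp A i x \<in> A i" "x - hcomp A i x \<in> A (i + 1)"
    using hcomp_unique by auto
qed

lemma hcomp_sum: "hcomp A 0 x + hcomp A 1 x = x"
proof -
  have "x - hcomp A 0 x \<in> A 1" "hcomp A 0 x \<in> A 0"
    using hcomp_in[where i = 0 and x = x] by simp_all
  then have "hcomp A 1 x = x - hcomp A 0 x"
    by (intro hcomp_unique) simp_all
  then show ?thesis by simp
qed

lemma hcomp_homogeneous: "x \<in> A j \<Longrightarrow> hcomp A i x = (if i = j then x else 0)"
  by (cases i; cases j) (auto intro!: hcomp_unique simp: A_zero)

lemma hcomp_add: "hcomp A i (x + y) = hcomp A i x + hcomp A i y"
proof (rule hcomp_unique)
  have "(x - hcomp A i x) + (y - hcomp A i y) \<in> A (i + 1)"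
    by (intro subspace_add subspace_A hcomp_in)
  then show "x + y - (hcomp A i x + hcomp A i y) \<in> A (i + 1)"
    by (simp add: algebra_simps)
qed (intro subspace_add subspace_A hcomp_in)

lemma hcomp_scale: "hcomp A i (scale c x) = scale c (hcomp A i x)"
proof (rule hcomp_unique)
  have "scale c (x - hcomp A i x) \<in> A (i + 1)"
    by (intro subspace_scale subspace_A hcomp_in)
  then show "scale c x - scale c (hcomp A i x) \<in> A (i + 1)"
    by (simp add: scale_right_diff_distrib)
qed (intro subspace_scale subspace_A hcomp_in)

lemma hcomp_0 [simp]: "hcomp A i 0 = 0"
  by (rule hcomp_unique) (simp_all add: A_zero)

lemma hcomp1_homogeneous:
  assumes "Vector_Spaces.linear scale scale f" "homogeneous1 A e f"
  shows "hcomp1 A d f = (if d = e then f else (\<lambda>x. 0))"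
proof
  fix x
  have "hcomp A (i + d) (f (hcomp A i x)) = (if d = e then f (hcomp A i x) else 0)" for i
    using hcomp_homogeneous[of "f (hcomp A i x)" "i + e" "i + d"] assms(2) hcomp_in(1)
    unfolding homogeneous1_def by auto
  moreover have "f (hcomp A 0 x) + f (hcomp A 1 x) = f x"
    by (metis assms(1) hcomp_sum Vector_Spaces.linear_iff)
  ultimately show "hcomp1 A d f x = (if d = e then f else (\<lambda>x. 0)) x"
    by (simp add: hcomp1_def)
qed

lemma hcomp2_homogeneous:
  assumes "\<And>y. Vector_Spaces.linear scale scale (\<lambda>x. f x y)"
    and "\<And>x. Vector_Spaces.linear scale scale (\<lambda>y. f x y)"
    and "homogeneous2 A e f"
  shows "hcomp2 A d f = (if d = e then f else (\<lambda>x y. 0))"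
proof (intro ext)
  fix x y
  have *: "hcomp A (i + j + d) (f (hcomp A i x) (hcomp A j y))
      = (if d = e then f (hcomp A i x) (hcomp A j y) else 0)" for i j
    using hcomp_homogeneous[of "f (hcomp A i x) (hcomp A j y)" "i + j + e" "i + j + d"]
      assms(3) hcomp_in(1)
    unfolding homogeneous2_def by auto
  have "f u (hcomp A 0 y) + f u (hcomp A 1 y) = f u y" for u
    by (metis assms(2) hcomp_sum Vector_Spaces.linear_iff)
  moreover have "f (hcomp A 0 x) y + f (hcomp A 1 x) y = f x y"
    using assms(1)[of y] hcomp_sum[of x] unfolding Vector_Spaces.linear_iff by metis
  ultimately show "hcomp2 A d f x y = (if d = e then f else (\<lambda>x y. 0)) x y"
    unfolding hcomp2_def * by simp
qed

end

context hom_novikov_superalgebra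
begin

lemma mul_simps [simp]:
  "0 \<star> x = 0" "x \<star> 0 = 0"
  "(x + y) \<star> z = x \<star> z + y \<star> z" "x \<star> (y + z) = x \<star> y + x \<star> z"
  "scale c x \<star> y = scale c (x \<star> y)" "x \<star> scale c y = scale c (x \<star> y)"
proof -
  show a: "(x + y) \<star> z = x \<star> z + y \<star> z" "x \<star> (y + z) = x \<star> y + x \<star> z" for x y z
    using mul_linear_left[of z] mul_linear_right[of x] by (simp_all add: Vector_Spaces.linear_iff)
  show "0 \<star> x = 0" "x \<star> 0 = 0"
    using a(1)[of 0 0 x] a(2)[of x 0 0] by simp_all
  show "scale c x \<star> y = scale c (x \<star> y)" "x \<star> scale c y = scale c (x \<star> y)"
    using mul_linear_left[of y] mul_linear_right[of x] by (simp_all add: Vector_Spaces.linear_iff)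
qed

lemma \<alpha>_0 [simp]: "\<alpha> 0 = 0"
  using \<alpha>_linear by (metis add_cancel_right_left Vector_Spaces.linear_iff)

lemma delta1_homogeneous:
  assumes "f \<in> hom_cochain1 scale \<alpha>" "homogeneous1 A d f" "x \<in> A i" "y \<in> A j"
  shows "delta1 A mul f x y = sg (i * d) (x \<star> f y) + f x \<star> y - f (x \<star> y)"
proof -
  have lin: "Vector_Spaces.linear scale scale f"
    using assms(1) by (simp add: hom_cochain1_def)
  then have [simp]: "f 0 = 0"
    by (metis add_cancel_right_left Vector_Spaces.linear_iff)
  show ?thesis
    unfolding delta1_def hcomp1_homogeneous[OF lin assms(2)]
      hcomp_homogeneous[OF assms(3)] hcomp_homogeneous[OF assms(4)]
    by (cases d; cases i; cases j) (simp_all add: delta1_at_def)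
qed

lemma delta2_homogeneous:
  assumes "f \<in> hom_cochain2 scale \<alpha>" "homogeneous2 A d f" "x1 \<in> A i" "x2 \<in> A j" "x3 \<in> A k"
  shows "delta2 A mul \<alpha> f x1 x2 x3 =
      f (\<alpha> x1) (x2 \<star> x3)
    - sg (i * j) (f (\<alpha> x2) (x1 \<star> x3))
    + sg (i * j) (f (x2 \<star> x1) (\<alpha> x3))
    + sg (i * d) (\<alpha> x1 \<star> f x2 x3)
    - sg (i * j + j * d) (\<alpha> x2 \<star> f x1 x3)
    + sg (i * j) (f x2 x1 \<star> \<alpha> x3)
    - sg (j * k) (f (x1 \<star> x3) (\<alpha> x2))
    - sg (j * k) (f x1 x3 \<star> \<alpha> x2)"
proof -
  have lin: "Vector_Spaces.linear scale scale (\<lambda>x. f x y)"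
      "Vector_Spaces.linear scale scale (\<lambda>y. f x y)" for x y
    using assms(1) by (simp_all add: hom_cochain2_def)
  then have [simp]: "f 0 y = 0" "f y 0 = 0" for y
    by (metis (no_types) add_cancel_right_left Vector_Spaces.linear_iff)+
  show ?thesis
    unfolding delta2_def hcomp2_homogeneous[OF lin assms(2)]
      hcomp_homogeneous[OF assms(3)] hcomp_homogeneous[OF assms(4)] hcomp_homogeneous[OF assms(5)]
    by (cases d; cases i; cases j; cases k) (simp_all add: delta2_at_def)
qed

lemma delta1_linear:
  "delta1 A mul (\<lambda>x. f x + g x) x y = delta1 A mul f x y + delta1 A mul g x y"
  "delta1 A mul (\<lambda>x. scale c (f x)) x y = scale c (delta1 A mul f x y)"
proof -
  have h: "hcomp1 A d (\<lambda>x. f x + g x) = (\<lambda>x. hcomp1 A d f x + hcomp1 A d g x)"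
    "hcomp1 A d (\<lambda>x. scale c (f x)) = (\<lambda>x. scale c (hcomp1 A d f x))" for d
    by (simp_all add: fun_eq_iff hcomp1_def hcomp_add hcomp_scale scale_right_distrib)
  have sg: "sg e (u + v) = sg e u + sg e v" "sg e (scale c u) = scale c (sg e u)" for e u v
    by (simp_all add: sg_def)
  have a: "delta1_at mul d i (\<lambda>x. F x + G x) x y = delta1_at mul d i F x y + delta1_at mul d i G x y"
    "delta1_at mul d i (\<lambda>x. scale c (F x)) x y = scale c (delta1_at mul d i F x y)" for d i F G x y
    by (simp_all add: delta1_at_def sg scale_right_distrib scale_right_diff_distrib)
  show "delta1 A mul (\<lambda>x. f x + g x) x y = delta1 A mul f x y + delta1 A mul g x y"
    "delta1 A mul (\<lambda>x. scale c (f x)) x y = scale c (delta1 A mul f x y)"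
    unfolding delta1_def h a by (simp_all only: sum.distrib scale_sum_right)
qed

lemma delta2_linear:
  "delta2 A mul \<alpha> (\<lambda>x y. f x y + g x y) x y z = delta2 A mul \<alpha> f x y z + delta2 A mul \<alpha> g x y z"
  "delta2 A mul \<alpha> (\<lambda>x y. scale c (f x y)) x y z = scale c (delta2 A mul \<alpha> f x y z)"
proof -
  have h: "hcomp2 A d (\<lambda>x y. f x y + g x y) = (\<lambda>x y. hcomp2 A d f x y + hcomp2 A d g x y)"
    "hcomp2 A d (\<lambda>x y. scale c (f x y)) = (\<lambda>x y. scale c (hcomp2 A d f x y))" for d
    by (simp_all add: fun_eq_iff hcomp2_def hcomp_add hcomp_scale scale_right_distrib)
  have sg: "sg e (u + v) = sg e u + sg e v" "sg e (scale c u) = scale c (sg e u)" for e u v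
    by (simp_all add: sg_def)
  have a: "delta2_at mul \<alpha> d i j k (\<lambda>x y. F x y + G x y) x y z
      = delta2_at mul \<alpha> d i j k F x y z + delta2_at mul \<alpha> d i j k G x y z"
    "delta2_at mul \<alpha> d i j k (\<lambda>x y. scale c (F x y)) x y z
      = scale c (delta2_at mul \<alpha> d i j k F x y z)" for d i j k F G x y z
    by (simp_all add: delta2_at_def sg scale_right_distrib scale_right_diff_distrib)
  show "delta2 A mul \<alpha> (\<lambda>x y. f x y + g x y) x y z
      = delta2 A mul \<alpha> f x y z + delta2 A mul \<alpha> g x y z"
    "delta2 A mul \<alpha> (\<lambda>x y. scale c (f x y)) x y z = scale c (delta2 A mul \<alpha> f x y z)"
    unfolding delta2_def h a by (simp_all only: sum.distrib scale_sum_right)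
qed

end

end

theory Submission
  imports Defs
begin

text \<open>
  Under right commutativity, left symmetry of a product \<open>\<star>\<close> is the single identity
  \<open>E(x, y, z) = 0\<close> for
  \<open>E(x, y, z) = \<alpha> x \<star> (y \<star> z) - (-1)\<^sup>i\<^sup>j \<alpha> y \<star> (x \<star> z) + (-1)\<^sup>i\<^sup>j (y \<star> x) \<star> \<alpha> z - (-1)\<^sup>j\<^sup>k (x \<star> z) \<star> \<alpha> y\<close>
  (\<open>i\<close>, \<open>j\<close>, \<open>k\<close> being the degrees of \<open>x\<close>, \<open>y\<close>, \<open>z\<close>), and \<open>\<delta>\<^sup>2 F\<close> is the first-order variation of \<open>E\<close> when \<open>\<star>\<close> is deformed in the direction \<open>F\<close>.
  The direction \<open>F = \<delta>\<^sup>1 f\<close> is an infinitesimal change of variables, so \<open>\<delta>\<^sup>2 \<delta>\<^sup>1 f\<close> is the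
  deviation of \<open>f\<close> from being a derivation of \<open>E\<close>:
  up to signs, \<open>E(f x, y, z) + E(x, f y, z) + E(x, y, f z) - f (E(x, y, z))\<close>.  All four terms vanish.
\<close>

section \<open>Signs and additivity of cochains\<close>

lemma sg_add: "sg e (u + v) = sg e u + sg e v"
  by (simp add: sg_def)

lemma sg_diff: "sg e (u - v) = sg e u - sg e v"
  by (simp add: sg_def)

lemma hom_cochain1_add: "f \<in> hom_cochain1 scale \<alpha> \<Longrightarrow> f (x + y) = f x + f y"
  by (simp add: hom_cochain1_def Vector_Spaces.linear_iff)

lemma hom_cochain1_minus: "f \<in> hom_cochain1 scale \<alpha> \<Longrightarrow> f (- x) = - f x"
  by (metis add.right_inverse add_cancel_right_right hom_cochain1_add minus_unique)

lemma hom_cochain1_diff: "f \<in> hom_cochain1 scale \<alpha> \<Longrightarrow> f (x - y) = f x - f y"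
  by (metis hom_cochain1_add hom_cochain1_minus diff_conv_add_uminus)

lemma hom_cochain1_scale: "f \<in> hom_cochain1 scale \<alpha> \<Longrightarrow> f (scale c x) = scale c (f x)"
  by (simp add: hom_cochain1_def Vector_Spaces.linear_iff)

lemma hom_cochain1_comm: "f \<in> hom_cochain1 scale \<alpha> \<Longrightarrow> \<alpha> (f x) = f (\<alpha> x)"
  by (simp add: hom_cochain1_def)

lemma hom_cochain2_add:
  assumes "f \<in> hom_cochain2 scale \<alpha>"
  shows "f (x + y) z = f x z + f y z" "f z (x + y) = f z x + f z y"
  using assms by (simp_all add: hom_cochain2_def Vector_Spaces.linear_iff)

lemma hom_cochain2_scale:
  assumes "f \<in> hom_cochain2 scale \<alpha>"
  shows "f (scale c x) z = scale c (f x z)" "f z (scale c x) = scale c (f z x)"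
  using assms by (simp_all add: hom_cochain2_def Vector_Spaces.linear_iff)

lemma hom_cochain2_comm: "f \<in> hom_cochain2 scale \<alpha> \<Longrightarrow> \<alpha> (f x y) = f (\<alpha> x) (\<alpha> y)"
  by (simp add: hom_cochain2_def)

lemma hom_cochain3_add:
  assumes "f \<in> hom_cochain3 scale \<alpha>"
  shows "f (x + y) z w = f x z w + f y z w" "f z (x + y) w = f z x w + f z y w"
    "f z w (x + y) = f z w x + f z w y"
  using assms by (simp_all add: hom_cochain3_def Vector_Spaces.linear_iff)

context vector_space
begin

lemma sg_scale: "sg e (scale c u) = scale c (sg e u)"
  by (simp add: sg_def)

lemma linear_endoI:
  assumes "\<And>x y. f (x + y) = f x + f y" "\<And>c x. f (scale c x) = scale c (f x)"
  shows "Vector_Spaces.linear scale scale f"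
  using assms by (simp add: Vector_Spaces.linear_iff vector_space_axioms)

end

section \<open>Homogeneous components of linear maps\<close>

context super_space
begin

lemma sg_in: "x \<in> A i \<Longrightarrow> sg e x \<in> A i"
  by (simp add: sg_def subspace_neg subspace_A)

text \<open>The four summands regroup by the component of the argument: for each one, both
  components of its image under \<open>f\<close> occur, one for each \<open>d\<close>.\<close>

lemma hcomp1_sum:
  assumes "Vector_Spaces.linear scale scale f"
  shows "hcomp1 A 0 f x + hcomp1 A 1 f x = f x"
proof -
  have "hcomp1 A 0 f x + hcomp1 A 1 f x
      = (hcomp A 0 (f (hcomp A 0 x)) + hcomp A 1 (f (hcomp A 0 x)))
      + (hcomp A 0 (f (hcomp A 1 x)) + hcomp A 1 (f (hcomp A 1 x)))"
    by (simp add: hcomp1_def algebra_simps)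
  also have "\<dots> = f (hcomp A 0 x) + f (hcomp A 1 x)"
    by (simp only: hcomp_sum)
  also have "\<dots> = f (hcomp A 0 x + hcomp A 1 x)"
    using assms by (simp only: Vector_Spaces.linear_iff)
  finally show ?thesis by (simp add: hcomp_sum)
qed

text \<open>On \<open>A i\<close> only the summand of index \<open>i\<close> survives, because the
  other component of the argument is 0 and \<open>f 0 = 0\<close>. What remains projects to degree
  \<open>i + d\<close>.\<close>

lemma homogeneous1_hcomp1:
  assumes "Vector_Spaces.linear scale scale f"
  shows "homogeneous1 A d (hcomp1 A d f)"
proof -
  have [simp]: "f 0 = 0"
    using assms by (metis add_cancel_right_left Vector_Spaces.linear_iff)
  have "hcomp1 A d f x = hcomp A (i + d) (f x)" if "x \<in> A i" for i x
    by (cases i) (simp_all add: hcomp1_def hcomp_homogeneous[OF that])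
  then show ?thesis
    by (simp add: homogeneous1_def hcomp_in)
qed

end

context hom_novikov_superalgebra
begin

lemma mul_diff: "(x - y) \<star> z = x \<star> z - y \<star> z" "z \<star> (x - y) = z \<star> x - z \<star> y"
  by (metis mul_simps(3) diff_add_cancel eq_diff_eq)
    (metis mul_simps(4) diff_add_cancel eq_diff_eq)

lemma mul_minus: "(- x) \<star> z = - (x \<star> z)" "z \<star> (- x) = - (z \<star> x)"
  using mul_diff[of 0 x z] mul_diff(2)[of z 0 x] by simp_all

lemma \<alpha>_add: "\<alpha> (x + y) = \<alpha> x + \<alpha> y"
  and \<alpha>_scale: "\<alpha> (scale c x) = scale c (\<alpha> x)"
  using \<alpha>_linear by (simp_all add: Vector_Spaces.linear_iff)

text \<open>Lets the cochain rules for differences and negatives apply to \<alpha> itself.\<close>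

lemma \<alpha>_cochain: "\<alpha> \<in> hom_cochain1 scale \<alpha>"
  by (simp add: hom_cochain1_def \<alpha>_linear)

lemma \<alpha>_diff: "\<alpha> (x - y) = \<alpha> x - \<alpha> y"
  by (rule hom_cochain1_diff[OF \<alpha>_cochain])

lemma \<alpha>_sg: "\<alpha> (sg e x) = sg e (\<alpha> x)"
  by (simp add: sg_def hom_cochain1_minus[OF \<alpha>_cochain])

text \<open>The axiom covers homogeneous factors only. Both sides are biadditive, so splitting each
  factor into components gives the general case.\<close>

lemma \<alpha>_mul': "\<alpha> (x \<star> y) = \<alpha> x \<star> \<alpha> y"
proof -
  have "\<alpha> ((hcomp A 0 x + hcomp A 1 x) \<star> (hcomp A 0 y + hcomp A 1 y))
      = \<alpha> (hcomp A 0 x + hcomp A 1 x) \<star> \<alpha> (hcomp A 0 y + hcomp A 1 y)"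
    by (simp add: \<alpha>_add \<alpha>_mul[OF hcomp_in(1) hcomp_in(1)])
  then show ?thesis
    by (simp add: hcomp_sum)
qed

text \<open>Being even and additive, \<alpha> carries the decomposition of \<open>x\<close> to one
  of \<open>\<alpha> x\<close>, and decompositions are unique.\<close>

lemma hcomp_\<alpha>: "hcomp A i (\<alpha> x) = \<alpha> (hcomp A i x)"
proof (rule hcomp_unique)
  show "\<alpha> x - \<alpha> (hcomp A i x) \<in> A (i + 1)"
    unfolding \<alpha>_diff[symmetric] by (intro \<alpha>_even hcomp_in)
qed (intro \<alpha>_even hcomp_in)

lemma hcomp1_cochain:
  assumes f: "f \<in> hom_cochain1 scale \<alpha>"
  shows "hcomp1 A d f \<in> hom_cochain1 scale \<alpha>"
proof -
  have "Vector_Spaces.linear scale scale (hcomp1 A d f)"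
    by (rule linear_endoI)
      (simp_all add: hcomp1_def hcomp_add hcomp_scale hom_cochain1_add[OF f]
        hom_cochain1_scale[OF f] scale_right_distrib)
  moreover have "\<alpha> (hcomp1 A d f x) = hcomp1 A d f (\<alpha> x)" for x
    by (simp add: hcomp1_def \<alpha>_add hcomp_\<alpha> flip: hom_cochain1_comm[OF f])
  ultimately show ?thesis
    by (simp add: hom_cochain1_def)
qed

lemma hcomp2_cochain:
  assumes f: "f \<in> hom_cochain2 scale \<alpha>"
  shows "hcomp2 A d f \<in> hom_cochain2 scale \<alpha>"
proof -
  have "Vector_Spaces.linear scale scale (\<lambda>x. hcomp2 A d f x y)"
    "Vector_Spaces.linear scale scale (\<lambda>x. hcomp2 A d f y x)" for y
    by (rule linear_endoI;
      simp add: hcomp2_def hcomp_add hcomp_scale hom_cochain2_add[OF f]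
        hom_cochain2_scale[OF f] scale_right_distrib)+
  moreover have "\<alpha> (hcomp2 A d f x y) = hcomp2 A d f (\<alpha> x) (\<alpha> y)" for x y
    by (simp add: hcomp2_def \<alpha>_add hcomp_\<alpha> flip: hom_cochain2_comm[OF f])
  ultimately show ?thesis
    by (simp add: hom_cochain2_def)
qed

section \<open>The coboundary operators map cochains to cochains\<close>

lemma delta1_cochain:
  assumes "f \<in> hom_cochain1 scale \<alpha>"
  shows "delta1 A mul f \<in> hom_cochain2 scale \<alpha>"
proof -
  note h = hcomp1_cochain[OF assms]
  note F = hom_cochain1_add[OF h] hom_cochain1_scale[OF h]
  have "Vector_Spaces.linear scale scale (\<lambda>x. delta1 A mul f x y)"
    "Vector_Spaces.linear scale scale (\<lambda>x. delta1 A mul f y x)" for y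
    by (rule linear_endoI;
      simp add: delta1_def delta1_at_def hcomp_add hcomp_scale F sg_add sg_scale
        scale_right_distrib scale_right_diff_distrib)+
  moreover have "\<alpha> (delta1 A mul f x y) = delta1 A mul f (\<alpha> x) (\<alpha> y)" for x y
    by (simp add: delta1_def delta1_at_def \<alpha>_add \<alpha>_diff \<alpha>_sg \<alpha>_mul' hcomp_\<alpha>
        hom_cochain1_comm[OF h])
  ultimately show ?thesis
    by (simp add: hom_cochain2_def)
qed

lemma delta2_cochain:
  assumes "f \<in> hom_cochain2 scale \<alpha>"
  shows "delta2 A mul \<alpha> f \<in> hom_cochain3 scale \<alpha>"
proof -
  note h = hcomp2_cochain[OF assms]
  note F = hom_cochain2_add[OF h] hom_cochain2_scale[OF h]
  note expand = delta2_at_def hcomp_add hcomp_scale F \<alpha>_add \<alpha>_scale sg_add sg_scale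
    scale_right_distrib scale_right_diff_distrib
  \<comment> \<open>The signs depend only on the indices \<open>d\<close>, \<open>i\<close>,
    \<open>j\<close>, \<open>k\<close>, so each of the sixteen summands is trilinear in arbitrary
    arguments, homogeneous or not.\<close>
  have at: "delta2_at mul \<alpha> d i j k (hcomp2 A d f) (x + x') y z
        = delta2_at mul \<alpha> d i j k (hcomp2 A d f) x y z + delta2_at mul \<alpha> d i j k (hcomp2 A d f) x' y z"
    "delta2_at mul \<alpha> d i j k (hcomp2 A d f) y (x + x') z
        = delta2_at mul \<alpha> d i j k (hcomp2 A d f) y x z + delta2_at mul \<alpha> d i j k (hcomp2 A d f) y x' z"
    "delta2_at mul \<alpha> d i j k (hcomp2 A d f) y z (x + x')
        = delta2_at mul \<alpha> d i j k (hcomp2 A d f) y z x + delta2_at mul \<alpha> d i j k (hcomp2 A d f) y z x'"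
    "delta2_at mul \<alpha> d i j k (hcomp2 A d f) (scale c x) y z
        = scale c (delta2_at mul \<alpha> d i j k (hcomp2 A d f) x y z)"
    "delta2_at mul \<alpha> d i j k (hcomp2 A d f) y (scale c x) z
        = scale c (delta2_at mul \<alpha> d i j k (hcomp2 A d f) y x z)"
    "delta2_at mul \<alpha> d i j k (hcomp2 A d f) y z (scale c x)
        = scale c (delta2_at mul \<alpha> d i j k (hcomp2 A d f) y z x)"
    for d i j k x x' y z c
    by (simp_all add: expand)
  have comm: "\<alpha> (delta2_at mul \<alpha> d i j k (hcomp2 A d f) x y z)
      = delta2_at mul \<alpha> d i j k (hcomp2 A d f) (\<alpha> x) (\<alpha> y) (\<alpha> z)" for d i j k x y z
    by (simp only: delta2_at_def \<alpha>_add \<alpha>_diff \<alpha>_sg \<alpha>_mul' hom_cochain2_comm[OF h])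
  have "Vector_Spaces.linear scale scale (\<lambda>x. delta2 A mul \<alpha> f x y z)"
    "Vector_Spaces.linear scale scale (\<lambda>x. delta2 A mul \<alpha> f y x z)"
    "Vector_Spaces.linear scale scale (\<lambda>x. delta2 A mul \<alpha> f y z x)" for y z
    by (rule linear_endoI;
      simp only: delta2_def hcomp_add hcomp_scale at sum.distrib scale_sum_right)+
  moreover have "\<alpha> (delta2 A mul \<alpha> f x y z) = delta2 A mul \<alpha> f (\<alpha> x) (\<alpha> y) (\<alpha> z)" for x y z
    by (simp add: delta2_def \<alpha>_add hcomp_\<alpha> comm)
  ultimately show ?thesis
    by (simp add: hom_cochain3_def)
qed

text \<open>Makes \<open>d\<close> the degree that enters the signs when
  \<open>delta2_homogeneous\<close> is applied to \<open>delta1 A mul f\<close>.\<close>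

lemma homogeneous2_delta1:
  assumes "f \<in> hom_cochain1 scale \<alpha>" "homogeneous1 A d f"
  shows "homogeneous2 A d (delta1 A mul f)"
  unfolding homogeneous2_def
proof (intro allI ballI)
  fix i j x y assume xy: "x \<in> A i" "y \<in> A j"
  have f: "u \<in> A l \<Longrightarrow> f u \<in> A (l + d)" for u l
    using assms(2) by (simp add: homogeneous1_def)
  have "x \<star> f y \<in> A (i + j + d)" "f x \<star> y \<in> A (i + j + d)" "f (x \<star> y) \<in> A (i + j + d)"
    using mul_even[OF xy(1) f[OF xy(2)]] mul_even[OF f[OF xy(1)] xy(2)] f[OF mul_even[OF xy]]
    by (simp_all only: ac_simps)
  then show "delta1 A mul f x y \<in> A (i + j + d)"
    unfolding delta1_homogeneous[OF assms xy]
    by (intro subspace_add subspace_diff subspace_A sg_in)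
qed

section \<open>Vanishing of the composite\<close>

definition novikov_defect :: "bit \<Rightarrow> bit \<Rightarrow> bit \<Rightarrow> 'a \<Rightarrow> 'a \<Rightarrow> 'a \<Rightarrow> 'a"
  where "novikov_defect i j k x y z =
    \<alpha> x \<star> (y \<star> z) - sg (i * j) (\<alpha> y \<star> (x \<star> z)) + sg (i * j) ((y \<star> x) \<star> \<alpha> z)
      - sg (j * k) ((x \<star> z) \<star> \<alpha> y)"

text \<open>By left symmetry the first three terms add up to
  \<open>(x \<star> y) \<star> \<alpha> z\<close>; right commutativity cancels this against the
  fourth.\<close>

lemma novikov_defect_eq_0:
  assumes "x \<in> A i" "y \<in> A j" "z \<in> A k"
  shows "novikov_defect i j k x y z = 0"
  using left_symmetric[OF assms] right_commutative[OF assms]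
  by (simp add: novikov_defect_def sg_diff algebra_simps)

lemma delta2_delta1_homogeneous:
  assumes f: "f \<in> hom_cochain1 scale \<alpha>" and hom: "homogeneous1 A d f"
    and x: "x \<in> A i" and y: "y \<in> A j" and z: "z \<in> A k"
  shows "delta2 A mul \<alpha> (delta1 A mul f) x y z = 0"
proof -
  have fd: "u \<in> A l \<Longrightarrow> f u \<in> A (l + d)" for u l
    using hom by (simp add: homogeneous1_def)
  note d1 = delta1_homogeneous[OF f hom]
  \<comment> \<open>The argument pairs met by the inner coboundary, with their degrees; the pair
    \<open>x\<close>, \<open>z\<close> serves two terms.\<close>
  note d1s = d1[OF \<alpha>_even[OF x] mul_even[OF y z]] d1[OF \<alpha>_even[OF y] mul_even[OF x z]]
    d1[OF mul_even[OF y x] \<alpha>_even[OF z]] d1[OF y z] d1[OF x z] d1[OF y x]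
    d1[OF mul_even[OF x z] \<alpha>_even[OF y]]
  \<comment> \<open>The terms with \<open>f\<close> on an inner product, such as
    \<open>\<alpha> x \<star> f (y \<star> z)\<close>, cancel in four pairs. In the rest
    \<open>f (\<alpha> x)\<close> becomes \<open>\<alpha> (f x)\<close>; the outer signs come from
    moving \<open>f\<close> past \<open>x\<close>, or past \<open>x\<close> and
    \<open>y\<close>.\<close>
  have "delta2 A mul \<alpha> (delta1 A mul f) x y z
      = novikov_defect (i + d) j k (f x) y z + sg (i * d) (novikov_defect i (j + d) k x (f y) z)
        + sg ((i + j) * d) (novikov_defect i j (k + d) x y (f z))
        - f (novikov_defect i j k x y z)"
    unfolding delta2_homogeneous[OF delta1_cochain[OF f] homogeneous2_delta1[OF f hom] x y z] d1s
      novikov_defect_def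
    \<comment> \<open>Fixing all parities makes every sign explicit and leaves an identity in an
      abelian group.\<close>
    by (cases d; cases i; cases j; cases k)
      (simp_all add: sg_def mul_diff mul_minus hom_cochain1_comm[OF f]
        hom_cochain1_add[OF f] hom_cochain1_diff[OF f] hom_cochain1_minus[OF f])
  also have "\<dots> = 0"
    unfolding novikov_defect_eq_0[OF fd[OF x] y z] novikov_defect_eq_0[OF x fd[OF y] z]
      novikov_defect_eq_0[OF x y fd[OF z]] novikov_defect_eq_0[OF x y z]
    using hom_cochain1_diff[OF f, of 0 0] by simp
  finally show ?thesis .
qed

text \<open>Reduction to the homogeneous case: the composite is additive in the three arguments,
  being a 3-cochain, and in \<open>f\<close>, so all four split into components.\<close>

lemma delta2_delta1:
  assumes f: "f \<in> hom_cochain1 scale \<alpha>"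
  shows "delta2 A mul \<alpha> (delta1 A mul f) x y z = 0"
proof -
  have lin: "Vector_Spaces.linear scale scale f"
    using f by (simp add: hom_cochain1_def)
  have hom: "delta2 A mul \<alpha> (delta1 A mul (hcomp1 A d f)) x y z = 0" for d
  proof -
    let ?g = "delta2 A mul \<alpha> (delta1 A mul (hcomp1 A d f))"
    have "?g \<in> hom_cochain3 scale \<alpha>"
      by (intro delta2_cochain delta1_cochain hcomp1_cochain f)
    note add = hom_cochain3_add[OF this]
    have "?g (hcomp A i x) (hcomp A j y) (hcomp A k z) = 0" for i j k
      by (rule delta2_delta1_homogeneous[OF hcomp1_cochain[OF f] homogeneous1_hcomp1[OF lin]])
        (rule hcomp_in)+
    then have "?g (hcomp A 0 x + hcomp A 1 x) (hcomp A 0 y + hcomp A 1 y)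
        (hcomp A 0 z + hcomp A 1 z) = 0"
      by (simp only: add add_0)
    then show ?thesis
      by (simp only: hcomp_sum)
  qed
  have "delta1 A mul (\<lambda>x. hcomp1 A 0 f x + hcomp1 A 1 f x)
      = (\<lambda>x y. delta1 A mul (hcomp1 A 0 f) x y + delta1 A mul (hcomp1 A 1 f) x y)"
    by (intro ext delta1_linear)
  then have "delta1 A mul f
      = (\<lambda>x y. delta1 A mul (hcomp1 A 0 f) x y + delta1 A mul (hcomp1 A 1 f) x y)"
    by (simp only: hcomp1_sum[OF lin])
  then show ?thesis
    by (simp only: delta2_linear hom add_0)
qed

end

theorem theorem4p3:
  fixes scale :: "'k::field \<Rightarrow> 'a::ab_group_add \<Rightarrow> 'a"
    and A :: "bit \<Rightarrow> 'a set"
    and mul :: "'a \<Rightarrow> 'a \<Rightarrow> 'a"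
    and \<alpha> :: "'a \<Rightarrow> 'a"
  assumes "hom_novikov_superalgebra scale A mul \<alpha>"
  shows "delta1 A mul \<in> hom_cochain1 scale \<alpha> \<rightarrow> hom_cochain2 scale \<alpha> \<and>
    delta2 A mul \<alpha> \<in> hom_cochain2 scale \<alpha> \<rightarrow> hom_cochain3 scale \<alpha> \<and>
    (\<forall>f \<in> hom_cochain1 scale \<alpha>. delta2 A mul \<alpha> (delta1 A mul f) = (\<lambda>x y z. 0))"
proof -
  interpret hom_novikov_superalgebra scale A mul \<alpha> by (rule assms)
  show ?thesis
    by (simp add: delta1_cochain delta2_cochain delta2_delta1 fun_eq_iff)
qed

end
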